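(* Let $r,b>0$, let $\alpha_0:=1$ and $\alpha_\nu:=2^{r\cdot\nu^b}$ for integers $\nu\ge1$, let $k(x,y):=\sum_{\nu\in\mathbb{N}_0}\alpha_\nu^{-1}h_\nu(x)h_\nu(y)$ for $x,y\in\mathbb{R}$, and let $$\sigma:=\max\Bigl(1,\frac{1}{2b}\Bigr).$$ Then $H(k)\subseteq G^\sigma(\mathbb{R})$. In particular, $H(k)$ contains only real analytic functions if $b\ge1/2$.
   Context: $\mathbb{N}_0=\{0,1,2,\dots\}$. $h_\nu$ are the Hermite polynomials normalized in $L^2$ of the standard normal distribution: $h_\nu(x)=\sqrt{\nu!}\sum_{j=0}^{\lfloor \nu/2\rfloor}(-1)^j\frac{x^{\nu-2j}}{2^j\,j!\,(\nu-2j)!}$. The series defining $k$ converges absolutely for all $x,y\in\mathbb{R}$, and $H(k)$ is the reproducing kernel Hilbert space of real-valued functions on $\mathbb{R}$ with reproducing kernel $k$. For $\sigma\ge1$, the Gevrey class $G^\sigma(\mathbb{R})$ of index $\sigma$ consists of all infinitely differentiable functions $f$ on $\mathbb{R}$ such that for every $R>0$ there exists $c>0$ with $|f^{(\ell)}(x)|\le(c^{\ell+1}\,\ell!)^\sigma$ for all $\ell\in\mathbb{N}_0$ and $x\in[-R,R]$. ($G^1(\mathbb{R})$ is the class of real analytic functions on $\mathbb{R}$.) *)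

theory Defs
  imports "HOL-Analysis.Analysis"
begin

definition hermite :: "nat \<Rightarrow> real \<Rightarrow> real" where
  "hermite \<nu> x = sqrt (fact \<nu>) *
     (\<Sum>j = 0..\<nu> div 2. (- 1) ^ j * (x ^ (\<nu> - 2 * j) / (2 ^ j * fact j * fact (\<nu> - 2 * j))))"

definition alpha :: "real \<Rightarrow> real \<Rightarrow> nat \<Rightarrow> real" where
  "alpha r b \<nu> = (if \<nu> = 0 then 1 else 2 powr (r * real \<nu> powr b))"

definition hermite_kernel :: "real \<Rightarrow> real \<Rightarrow> real \<Rightarrow> real \<Rightarrow> real" where
  "hermite_kernel r b x y = (\<Sum>\<nu>. inverse (alpha r b \<nu>) * hermite \<nu> x * hermite \<nu> y)"

text \<open>
  A real Hilbert space \<open>H\<close> of real-valued functions on the type \<open>'a\<close>, with pointwise operations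
  and inner product \<open>ip\<close>. The function \<open>ip\<close> is total, but only its values on \<open>H\<close> are constrained.
\<close>

locale function_hilbert_space =
  fixes H :: "('a \<Rightarrow> real) set"
    and ip :: "('a \<Rightarrow> real) \<Rightarrow> ('a \<Rightarrow> real) \<Rightarrow> real"
  assumes zero_mem: "(\<lambda>x. 0) \<in> H"
    and add_mem: "f \<in> H \<Longrightarrow> g \<in> H \<Longrightarrow> (\<lambda>x. f x + g x) \<in> H"
    and scale_mem: "f \<in> H \<Longrightarrow> (\<lambda>x. c * f x) \<in> H"
    and ip_commute: "f \<in> H \<Longrightarrow> g \<in> H \<Longrightarrow> ip f g = ip g f"
    and ip_add_left:
      "f \<in> H \<Longrightarrow> g \<in> H \<Longrightarrow> h \<in> H \<Longrightarrow> ip (\<lambda>x. f x + g x) h = ip f h + ip g h"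
    and ip_scale_left: "f \<in> H \<Longrightarrow> g \<in> H \<Longrightarrow> ip (\<lambda>x. c * f x) g = c * ip f g"
    and ip_pos: "f \<in> H \<Longrightarrow> f \<noteq> (\<lambda>x. 0) \<Longrightarrow> 0 < ip f f"
    and complete:
      "\<lbrakk>\<And>n. F n \<in> H;
        \<And>\<epsilon>. 0 < \<epsilon> \<Longrightarrow>
          \<exists>N::nat. \<forall>m\<ge>N. \<forall>n\<ge>N. sqrt (ip (\<lambda>x. F m x - F n x) (\<lambda>x. F m x - F n x)) < \<epsilon>\<rbrakk>
       \<Longrightarrow> \<exists>f\<in>H. (\<lambda>n. sqrt (ip (\<lambda>x. F n x - f x) (\<lambda>x. F n x - f x))) \<longlonglongrightarrow> 0"

text \<open>
  By the Moore-Aronszajn theorem, every positive semidefinite kernel \<open>K\<close> determines exactly one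
  such space \<open>H\<close> (and \<open>ip\<close> on it), so \<open>rkhs H ip K\<close> says that \<open>H\<close> is the
  reproducing kernel Hilbert space of \<open>K\<close>.
\<close>

locale rkhs = function_hilbert_space H ip
  for H :: "('a \<Rightarrow> real) set" and ip :: "('a \<Rightarrow> real) \<Rightarrow> ('a \<Rightarrow> real) \<Rightarrow> real" +
  fixes K :: "'a \<Rightarrow> 'a \<Rightarrow> real"
  assumes kernel_mem: "K x \<in> H"
    and reproducing: "f \<in> H \<Longrightarrow> ip f (K x) = f x"

definition gevrey :: "real \<Rightarrow> (real \<Rightarrow> real) set" where
  "gevrey \<sigma> = {f.
     (\<forall>l x. (deriv ^^ l) f differentiable (at x)) \<and>
     (\<forall>R>0. \<exists>c>0. \<forall>l. \<forall>x\<in>{-R..R}.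
        \<bar>(deriv ^^ l) f x\<bar> \<le> (c ^ (l + 1) * fact l) powr \<sigma>)}"

definition real_analytic :: "(real \<Rightarrow> real) \<Rightarrow> bool" where
  "real_analytic f \<longleftrightarrow> (\<forall>x. \<exists>F. (\<lambda>t. f (x + t)) has_fps_expansion F)"

end

theory Submission
  imports Defs
begin

text \<open>
  Write \<open>w \<nu>\<close> for \<open>1 / \<alpha>\<^sub>\<nu>\<close>. The kernel is the Gram kernel of the feature vectors
  \<open>(h\<^sub>\<nu> x)\<^sub>\<nu>\<close> in the space of square-summable sequences with weights \<open>w\<close>. Testing \<open>f \<in> H\<close> against
  finite combinations of kernel sections, the reproducing property and the Cauchy-Schwarz inequality
  give

    \<open>(\<Sum>i. a i * f (x i))\<^sup>2 \<le> ip f f * (\<Sum>\<nu>. w \<nu> * (\<Sum>i. a i * h\<^sub>\<nu> (x i))\<^sup>2)\<close>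

  for all points and coefficients. The sum over \<open>\<nu>\<close> is the squared norm of the same combination of
  feature vectors, so \<open>f\<close> is at least as regular as the feature map: inserting difference
  quotients into the inequality shows that \<open>f\<close> is differentiable as soon as the feature map is, and
  that the inequality persists for the derivatives, with the same constant. This avoids expanding
  \<open>f\<close> in an orthonormal basis of \<open>H\<close>; see \<open>dominated_by_features\<close> and
  \<open>dominated_higher_derivatives\<close>. By iteration, the square of the \<open>l\<close>-th
  derivative of \<open>f\<close> at \<open>x\<close> is at most \<open>ip f f\<close> times the sum over \<open>\<nu>\<close> of \<open>w \<nu>\<close> times the square of
  the \<open>l\<close>-th derivative of \<open>h\<^sub>\<nu>\<close> at \<open>x\<close>.

  Since \<open>h\<^sub>\<nu>' = sqrt \<nu> * h\<^bsub>\<nu>-1\<^esub>\<close>, the \<open>l\<close>-th derivative of \<open>h\<^sub>\<nu>\<close> is at most \<open>\<nu>\<close> to the power \<open>l / 2\<close>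
  times a bound for the Hermite polynomials themselves, and these satisfy
  \<open>(h\<^sub>\<nu> x)\<^sup>2 \<le> exp (x\<^sup>2)\<close> uniformly in \<open>\<nu>\<close> by an energy argument (\<open>hermite_energy_le\<close>). It remains to
  estimate the sum of \<open>w \<nu> * \<nu> ^ l\<close>. The weight has the form \<open>exp (- 2 * \<rho> * \<nu> powr b)\<close>; one of the
  two factors \<open>exp (- \<rho> * \<nu> powr b)\<close> makes the series converge and the other one controls
  \<open>\<nu> ^ l\<close> at the price of \<open>q ^ l * fact l powr (1 / b)\<close> (\<open>power_le_gevrey_factor\<close>). Taking square roots
  yields the Gevrey index \<open>1 / (2 * b)\<close>. When this is at most 1, the bounds are
  \<open>c ^ (l + 1) * fact l\<close> and Taylor's formula gives analyticity.
\<close>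

section \<open>A uniform bound for Hermite polynomials and their derivatives\<close>

text \<open>
  The Taylor coefficients of \<open>exp (- t\<^sup>2 / 2)\<close>. Multiplying this series by \<open>exp (x * t)\<close> produces the
  generating function of the unnormalized Hermite polynomials \<open>hermite_appell\<close>; written this way,
  with a sum over all indices, derivative and recurrence need no parity distinction.
\<close>
definition hermite_gen :: "nat \<Rightarrow> real" where
  "hermite_gen i = (if even i then (- 1) ^ (i div 2) / (2 ^ (i div 2) * fact (i div 2)) else 0)"

definition hermite_appell :: "nat \<Rightarrow> real \<Rightarrow> real" where
  "hermite_appell n x = (\<Sum>i\<le>n. hermite_gen i * (x ^ (n - i) / fact (n - i)))"

lemma hermite_eq_appell: "hermite n x = sqrt (fact n) * hermite_appell n x"
proof -
  have "hermite_appell n x = (\<Sum>i\<in>(\<lambda>j. 2 * j) ` {0..n div 2}. hermite_gen i * (x ^ (n - i) / fact (n - i)))"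
    unfolding hermite_appell_def
  proof (rule sum.mono_neutral_right)
    show "\<forall>i\<in>{..n} - (\<lambda>j. 2 * j) ` {0..n div 2}. hermite_gen i * (x ^ (n - i) / fact (n - i)) = 0"
      by (auto simp: hermite_gen_def elim!: evenE)
  qed auto
  also have "\<dots> = (\<Sum>j = 0..n div 2. hermite_gen (2 * j) * (x ^ (n - 2 * j) / fact (n - 2 * j)))"
    by (subst sum.reindex) (auto simp: inj_on_def)
  finally show ?thesis
    by (simp add: hermite_def hermite_gen_def)
qed

text \<open>
  The coefficient form of \<open>E' = - t * E\<close> for \<open>E = exp (- t\<^sup>2 / 2)\<close>.
\<close>
lemma hermite_gen_rec: "real (Suc (Suc i)) * hermite_gen (Suc (Suc i)) = - hermite_gen i"
proof (cases "even i")
  case True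
  then obtain k where "i = 2 * k" by (elim evenE)
  then show ?thesis by (simp add: hermite_gen_def divide_simps)
qed (simp add: hermite_gen_def)

text \<open>
  Termwise differentiation; the last summand is the constant one and disappears.
\<close>
lemma DERIV_hermite_appell_Suc:
  "(hermite_appell (Suc n) has_real_derivative hermite_appell n x) (at x)"
proof -
  have "((\<lambda>x. \<Sum>i\<le>n. hermite_gen i * (x ^ (Suc n - i) / fact (Suc n - i))) has_real_derivative
      (\<Sum>i\<le>n. hermite_gen i * (x ^ (n - i) / fact (n - i)))) (at x)"
  proof (rule DERIV_sum)
    fix i assume "i \<in> {..n}"
    then have *: "Suc n - i = Suc (n - i)" by auto
    show "((\<lambda>x. hermite_gen i * (x ^ (Suc n - i) / fact (Suc n - i))) has_real_derivative
        hermite_gen i * (x ^ (n - i) / fact (n - i))) (at x)"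
      unfolding *
      by (rule DERIV_cmult, rule DERIV_cong[OF DERIV_cdivide[OF DERIV_pow]])
         (simp add: divide_simps)
  qed
  then have "((\<lambda>x. (\<Sum>i\<le>n. hermite_gen i * (x ^ (Suc n - i) / fact (Suc n - i))) + hermite_gen (Suc n))
      has_real_derivative hermite_appell n x) (at x)"
    unfolding hermite_appell_def by (rule DERIV_cong[OF DERIV_add[OF _ DERIV_const]]) simp
  then show ?thesis
    by (simp add: hermite_appell_def[abs_def])
qed

text \<open>
  The factor \<open>n + 2\<close> splits as \<open>(n + 2 - i) + i\<close> in the \<open>i\<close>-th summand. The first part cancels
  against the factorial and leaves \<open>x\<close> times the preceding polynomial; the second part is
  absorbed by the coefficient recursion and shifts the index by two.
\<close>
lemma hermite_appell_rec:
  "real (Suc (Suc n)) * hermite_appell (Suc (Suc n)) x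
     = x * hermite_appell (Suc n) x - hermite_appell n x"
proof -
  let ?N = "Suc (Suc n)"
  let ?t = "\<lambda>i. x ^ (?N - i) / fact (?N - i)"
  have "real ?N * hermite_appell ?N x = (\<Sum>i\<le>?N. real ?N * (hermite_gen i * ?t i))"
    by (simp only: hermite_appell_def sum_distrib_left)
  also have "\<dots> = (\<Sum>i\<le>?N. hermite_gen i * (real (?N - i) * ?t i) + real i * hermite_gen i * ?t i)"
  proof (rule sum.cong)
    fix i assume "i \<in> {..?N}"
    then have "real ?N = real (?N - i) + real i" by auto
    then show "real ?N * (hermite_gen i * ?t i)
        = hermite_gen i * (real (?N - i) * ?t i) + real i * hermite_gen i * ?t i"
      by (simp only: algebra_simps)
  qed simp
  also have "\<dots> = (\<Sum>i\<le>?N. hermite_gen i * (real (?N - i) * ?t i))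
                + (\<Sum>i\<le>?N. real i * hermite_gen i * ?t i)"
    by (rule sum.distrib)
  also have "(\<Sum>i\<le>?N. hermite_gen i * (real (?N - i) * ?t i))
      = (\<Sum>i\<le>Suc n. hermite_gen i * (real (?N - i) * ?t i))" by simp
  also have "\<dots> = (\<Sum>i\<le>Suc n. x * (hermite_gen i * (x ^ (Suc n - i) / fact (Suc n - i))))"
  proof (rule sum.cong)
    fix i assume "i \<in> {..Suc n}"
    then have *: "?N - i = Suc (Suc n - i)" by auto
    show "hermite_gen i * (real (?N - i) * ?t i) = x * (hermite_gen i * (x ^ (Suc n - i) / fact (Suc n - i)))"
      unfolding * by (simp add: divide_simps)
  qed simp
  also have "\<dots> = x * hermite_appell (Suc n) x"
    by (simp only: hermite_appell_def sum_distrib_left)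
  also have "(\<Sum>i\<le>?N. real i * hermite_gen i * ?t i)
      = (\<Sum>i\<le>n. real (Suc (Suc i)) * hermite_gen (Suc (Suc i)) * ?t (Suc (Suc i)))"
    by (simp only: sum.atMost_Suc_shift) (simp add: hermite_gen_def)
  also have "\<dots> = - hermite_appell n x"
    unfolding hermite_gen_rec by (simp add: hermite_appell_def sum_negf)
  finally show ?thesis by simp
qed

lemma DERIV_hermite_Suc:
  "(hermite (Suc n) has_real_derivative sqrt (real (Suc n)) * hermite n x) (at x)"
proof -
  have "((\<lambda>x. sqrt (fact (Suc n)) * hermite_appell (Suc n) x) has_real_derivative
      sqrt (fact (Suc n)) * hermite_appell n x) (at x)"
    by (intro DERIV_cmult DERIV_hermite_appell_Suc)
  then show ?thesis
    by (simp add: hermite_eq_appell[abs_def] real_sqrt_mult mult.assoc)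
qed

lemma hermite_0 [simp]: "hermite 0 x = 1"
  by (simp add: hermite_def)

lemma hermite_1 [simp]: "hermite (Suc 0) x = x"
  by (simp add: hermite_def)

lemma hermite_rec:
  "sqrt (real (Suc (Suc n))) * hermite (Suc (Suc n)) x
     = x * hermite (Suc n) x - sqrt (real (Suc n)) * hermite n x"
proof -
  have "sqrt (real (Suc (Suc n))) * hermite (Suc (Suc n)) x
      = sqrt (fact (Suc n)) * (sqrt (real (Suc (Suc n))) * sqrt (real (Suc (Suc n)))
          * hermite_appell (Suc (Suc n)) x)"
    unfolding hermite_eq_appell
    by (simp only: fact_Suc[of "Suc n"] of_nat_mult real_sqrt_mult mult_ac)
  also have "\<dots> = sqrt (fact (Suc n)) * (x * hermite_appell (Suc n) x - hermite_appell n x)"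
    by (simp only: hermite_appell_rec real_sqrt_mult_self abs_of_nat)
  also have "\<dots> = x * hermite (Suc n) x - sqrt (real (Suc n)) * hermite n x"
    by (simp add: hermite_eq_appell real_sqrt_mult right_diff_distrib del: of_nat_Suc)
  finally show ?thesis .
qed

text \<open>
  The other first-order relation between neighbouring Hermite polynomials: the three-term recurrence
  trades the lower index in \<open>h\<^sub>n'\<close> for the higher one. Together with \<open>DERIV_hermite_Suc\<close> it
  makes the pair \<open>h\<^sub>n\<close>, \<open>h\<^bsub>n+1\<^esub>\<close> a closed linear system of differential equations.
\<close>
lemma DERIV_hermite_lowest:
  "(hermite n has_real_derivative x * hermite n x - sqrt (real (Suc n)) * hermite (Suc n) x) (at x)"
proof (cases n)
  case 0
  then show ?thesis by (simp add: hermite_0[abs_def])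
next
  case (Suc m)
  show ?thesis
    using DERIV_hermite_Suc[of m x] unfolding Suc hermite_rec by simp
qed

text \<open>
  The two off-diagonal entries \<open>sqrt (n + 1)\<close> and \<open>- sqrt (n + 1)\<close> of that system are opposite, so they
  cancel in the derivative of the sum of squares. What remains has the coefficient \<open>2 * x\<close> for every \<open>n\<close>,
  whence a bound uniform in the degree.
\<close>
definition hermite_energy :: "nat \<Rightarrow> real \<Rightarrow> real" where
  "hermite_energy n x = (hermite (Suc n) x)\<^sup>2 + (hermite n x)\<^sup>2"

text \<open>
  At the origin the recurrence reads \<open>sqrt (n + 2) * h\<^bsub>n+2\<^esub> = - sqrt (n + 1) * h\<^sub>n\<close>, so the energy there
  does not increase with \<open>n\<close>.
\<close>
lemma hermite_energy_0_le: "hermite_energy n 0 \<le> 1"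
proof (induction n)
  case 0
  then show ?case by (simp add: hermite_energy_def)
next
  case (Suc n)
  have "real (Suc (Suc n)) * (hermite (Suc (Suc n)) 0)\<^sup>2 = (sqrt (real (Suc (Suc n))) * hermite (Suc (Suc n)) 0)\<^sup>2"
    by (simp only: power_mult_distrib) simp
  also have "\<dots> = real (Suc n) * (hermite n 0)\<^sup>2"
    unfolding hermite_rec by (simp only: power2_minus mult_zero_left diff_0 power_mult_distrib) simp
  also have "\<dots> \<le> real (Suc (Suc n)) * (hermite n 0)\<^sup>2"
    by (intro mult_right_mono) auto
  finally have "(hermite (Suc (Suc n)) 0)\<^sup>2 \<le> (hermite n 0)\<^sup>2"
    by (simp only: mult_le_cancel_left_pos of_nat_0_less_iff zero_less_Suc)
  with Suc show ?case by (simp add: hermite_energy_def)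
qed

text \<open>
  The derivative of the energy is \<open>2 * x * h\<^sub>n\<^sup>2\<close>, and the Gaussian factor subtracts \<open>2 * x\<close> times the
  whole energy.
\<close>
lemma DERIV_hermite_energy_gauss:
  "((\<lambda>x. hermite_energy n x * exp (- x\<^sup>2)) has_real_derivative
     - 2 * x * (hermite (Suc n) x)\<^sup>2 * exp (- x\<^sup>2)) (at x)"
  unfolding hermite_energy_def
  by (rule derivative_eq_intros DERIV_hermite_Suc DERIV_hermite_lowest refl)+
     (simp add: algebra_simps power2_eq_square)

text \<open>
  The product of energy and Gaussian increases up to the origin and decreases afterwards, so it is
  largest at the origin.
\<close>
lemma hermite_energy_le: "hermite_energy n x \<le> exp (x\<^sup>2)"
proof -
  let ?g = "\<lambda>x. hermite_energy n x * exp (- x\<^sup>2)"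
  have "?g x \<le> ?g 0"
  proof (cases "0 \<le> x")
    case True
    then show ?thesis
    proof (rule DERIV_nonpos_imp_nonincreasing)
      fix t assume t: "0 \<le> t" "t \<le> x"
      show "\<exists>y. (?g has_real_derivative y) (at t) \<and> y \<le> 0"
        by (rule exI, rule conjI, rule DERIV_hermite_energy_gauss)
           (use t in \<open>simp add: mult_nonpos_nonneg\<close>)
    qed
  next
    case False
    then have "x \<le> 0" by simp
    then show ?thesis
    proof (rule DERIV_nonneg_imp_nondecreasing)
      fix t assume t: "x \<le> t" "t \<le> 0"
      show "\<exists>y. (?g has_real_derivative y) (at t) \<and> 0 \<le> y"
        by (rule exI, rule conjI, rule DERIV_hermite_energy_gauss)
           (use t in \<open>simp add: mult_nonpos_nonneg\<close>)
    qed
  qed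
  also have "\<dots> \<le> 1" using hermite_energy_0_le[of n] by simp
  finally show ?thesis by (simp add: exp_minus field_simps)
qed

lemma hermite_sq_le: "(hermite n x)\<^sup>2 \<le> exp (x\<^sup>2)"
  using hermite_energy_le[of n x] zero_le_power2[of "hermite (Suc n) x"]
  unfolding hermite_energy_def by linarith

text \<open>
  The \<open>l\<close>-th derivative of \<open>h\<^sub>n\<close>, as \<open>DERIV_hermite_deriv\<close> justifies.
\<close>
definition hermite_deriv :: "nat \<Rightarrow> nat \<Rightarrow> real \<Rightarrow> real" where
  "hermite_deriv l n x = (if l \<le> n then sqrt (fact n / fact (n - l)) * hermite (n - l) x else 0)"

lemma DERIV_hermite_deriv:
  "(hermite_deriv l n has_real_derivative hermite_deriv (Suc l) n x) (at x)"
proof -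
  consider "n < l" | "n = l" | m where "n = Suc m" "l \<le> m"
    using less_imp_Suc_add[of l n] by fastforce
  then show ?thesis
  proof cases
    case 3
    have "((\<lambda>x. sqrt (fact n / fact (n - l)) * hermite (Suc (m - l)) x) has_real_derivative
       sqrt (fact n / fact (n - l)) * (sqrt (real (Suc (m - l))) * hermite (m - l) x)) (at x)"
      by (intro DERIV_cmult DERIV_hermite_Suc)
    moreover have "sqrt (fact n / fact (n - l)) * sqrt (real (Suc (m - l))) = sqrt (fact n / fact (n - Suc l))"
      unfolding real_sqrt_mult[symmetric] using 3 
      by (simp add: Suc_diff_le divide_simps del: of_nat_Suc)
    ultimately show ?thesis
      using 3 by (simp add: hermite_deriv_def[abs_def] Suc_diff_le mult.assoc[symmetric])
  qed (simp_all add: hermite_deriv_def[abs_def])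
qed

lemma hermite_deriv_sq_le: "(hermite_deriv l n x)\<^sup>2 \<le> real n ^ l * exp (x\<^sup>2)"
proof (cases "l \<le> n")
  case True
  have "fact n / fact (n - l) \<le> real n ^ l"
  proof -
    have "fact n / fact (n - l) = real (fact n div fact (n - l))"
      by (simp add: real_of_nat_div fact_dvd)
    also have "\<dots> \<le> real (n ^ l)"
      using fact_div_fact_le_pow[OF True] by (simp only: of_nat_le_iff)
    finally show ?thesis by simp
  qed
  then have "fact n / fact (n - l) * (hermite (n - l) x)\<^sup>2 \<le> real n ^ l * exp (x\<^sup>2)"
    by (intro mult_mono hermite_sq_le) auto
  then show ?thesis
    using True by (simp add: hermite_deriv_def power_mult_distrib)
qed (simp add: hermite_deriv_def)

section \<open>Functions dominated by a feature map\<close>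
text \<open>
  A list of pairs of coefficient and point represents a finitely supported signed measure. Repeated
  points are allowed, so that difference quotients can be substituted without regard to collisions.
\<close>
definition lincomb :: "(real \<times> 'a) list \<Rightarrow> ('a \<Rightarrow> real) \<Rightarrow> real" where
  "lincomb L g = (\<Sum>(a, x)\<leftarrow>L. a * g x)"

lemma lincomb_Nil [simp]: "lincomb [] g = 0"
  and lincomb_Cons [simp]: "lincomb ((a, x) # L) g = a * g x + lincomb L g"
  and lincomb_append [simp]: "lincomb (L @ L') g = lincomb L g + lincomb L' g"
  by (simp_all add: lincomb_def)

lemma lincomb_cmult: "lincomb L (\<lambda>x. c * g x) = c * lincomb L g"
  by (induction L) (auto simp: algebra_simps)

lemma tendsto_lincomb:
  assumes "\<And>x. ((\<lambda>n. g n x) \<longlongrightarrow> g' x) F"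
  shows "((\<lambda>n. lincomb L (g n)) \<longlongrightarrow> lincomb L g') F"
  by (induction L) (auto intro!: tendsto_intros assms)

lemma sums_lincomb:
  assumes "\<And>x. (\<lambda>\<nu>. g \<nu> x) sums g' x"
  shows "(\<lambda>\<nu>. lincomb L (g \<nu>)) sums lincomb L g'"
  by (induction L) (auto intro!: sums_add sums_mult assms)

lemma abs_lincomb_le:
  assumes "\<And>a x. (a, x) \<in> set L \<Longrightarrow> \<bar>g x\<bar> \<le> B"
  shows "\<bar>lincomb L g\<bar> \<le> (\<Sum>(a, x)\<leftarrow>L. \<bar>a\<bar>) * B"
  using assms
proof (induction L)
  case (Cons p L)
  obtain a x where p: "p = (a, x)" by force
  have "\<bar>a * g x\<bar> \<le> \<bar>a\<bar> * B"
    unfolding abs_mult using Cons.prems[of a x] by (intro mult_left_mono) (auto simp: p)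
  moreover have "\<bar>lincomb L g\<bar> \<le> (\<Sum>(a, x)\<leftarrow>L. \<bar>a\<bar>) * B"
    using Cons.prems by (intro Cons.IH) auto
  ultimately show ?case by (simp add: p distrib_right)
qed simp

text \<open>
  A list \<open>L\<close> sends \<open>\<phi>\<close> to a vector in the space of square-summable sequences with weight \<open>w\<close>, and
  \<open>lincomb L f\<close> has to be a bounded linear functional of that vector. In other words, \<open>f x\<close> is the
  inner product of \<open>\<phi> x\<close> with a fixed vector; the inequality spares the construction of this vector,
  and its squared form keeps norms and square roots out of the calculations.
\<close>
definition dominated ::
  "real \<Rightarrow> (nat \<Rightarrow> real) \<Rightarrow> (nat \<Rightarrow> 'a \<Rightarrow> real) \<Rightarrow> ('a \<Rightarrow> real) \<Rightarrow> bool" where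
  "dominated C w \<phi> f \<longleftrightarrow> (\<forall>L. (lincomb L f)\<^sup>2 \<le> C * (\<Sum>\<nu>. w \<nu> * (lincomb L (\<phi> \<nu>))\<^sup>2))"

lemma dominated_pointwise:
  assumes "dominated C w \<phi> f"
  shows "(f x)\<^sup>2 \<le> C * (\<Sum>\<nu>. w \<nu> * (\<phi> \<nu> x)\<^sup>2)"
  using assms[unfolded dominated_def, rule_format, of "[(1, x)]"] by simp

context function_hilbert_space
begin

lemma lincomb_mem:
  assumes "\<And>x. \<Phi> x \<in> H"
  shows "(\<lambda>y. lincomb L (\<lambda>x. \<Phi> x y)) \<in> H"
  by (induction L) (auto intro!: zero_mem add_mem scale_mem assms)

lemma ip_zero_left: "g \<in> H \<Longrightarrow> ip (\<lambda>x. 0) g = 0"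
  using ip_scale_left[of g g 0] by simp

lemma ip_lincomb_left:
  assumes "\<And>x. \<Phi> x \<in> H" and "g \<in> H"
  shows "ip (\<lambda>y. lincomb L (\<lambda>x. \<Phi> x y)) g = lincomb L (\<lambda>x. ip (\<Phi> x) g)"
proof (induction L)
  case Nil
  then show ?case using assms by (simp add: ip_zero_left)
next
  case (Cons p L)
  then show ?case
    using assms by (cases p) (simp add: ip_add_left ip_scale_left scale_mem lincomb_mem)
qed

lemma ip_nonneg: "f \<in> H \<Longrightarrow> 0 \<le> ip f f"
  using ip_pos[of f] ip_zero_left[of f] by (cases "f = (\<lambda>x. 0)") auto

lemma ip_Cauchy_Schwarz:
  assumes f: "f \<in> H" and g: "g \<in> H"
  shows "(ip f g)\<^sup>2 \<le> ip f f * ip g g"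
proof (cases "g = (\<lambda>x. 0)")
  case True
  then show ?thesis using f ip_zero_left[of f] ip_commute[OF f g] ip_nonneg[OF g]
    by (simp add: ip_zero_left zero_mem)
next
  case False
  then have pos: "0 < ip g g" using ip_pos[OF g] by simp
  \<comment> \<open>The value of \<open>t\<close> that minimizes the norm of \<open>f + t * g\<close>.\<close>
  define t where "t = - ip f g / ip g g"
  let ?h = "\<lambda>x. f x + t * g x"
  have tg: "(\<lambda>x. t * g x) \<in> H" by (rule scale_mem[OF g])
  have h: "?h \<in> H" by (rule add_mem[OF f tg])
  have hx: "ip ?h k = ip f k + t * ip g k" if "k \<in> H" for k
    using ip_add_left[OF f tg that] ip_scale_left[OF g that] by simp
  have "0 \<le> ip ?h ?h" by (rule ip_nonneg[OF h])
  also have "\<dots> = ip f f + 2 * t * ip f g + t\<^sup>2 * ip g g"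
    using hx[OF h] hx[OF f] hx[OF g] ip_commute[OF f h] ip_commute[OF g h] ip_commute[OF g f]
    by (simp add: power2_eq_square algebra_simps)
  also have "\<dots> = ip f f - (ip f g)\<^sup>2 / ip g g"
    using pos by (simp add: t_def power2_eq_square field_simps)
  finally show ?thesis using pos by (simp add: field_simps)
qed

end

text \<open>
  The combination of values of \<open>f\<close> is the inner product of \<open>f\<close> with the same combination \<open>k\<close> of
  kernel sections. After Cauchy-Schwarz it remains to compute the squared norm of \<open>k\<close>; it is the
  combination of the values of \<open>k\<close> itself, and thus a double sum of kernel values that factors into squares.
\<close>
lemma (in rkhs) dominated_by_features:
  assumes K: "\<And>x y. (\<lambda>\<nu>. w \<nu> * \<phi> \<nu> x * \<phi> \<nu> y) sums K x y" and f: "f \<in> H"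
  shows "dominated (ip f f) w \<phi> f"
  unfolding dominated_def
proof
  fix L :: "(real \<times> 'a) list"
  let ?k = "\<lambda>y. lincomb L (\<lambda>x. K x y)"
  have k: "?k \<in> H" by (rule lincomb_mem[OF kernel_mem])
  have eval: "ip g ?k = lincomb L g" if "g \<in> H" for g
  proof -
    have "ip ?k g = lincomb L (\<lambda>x. ip (K x) g)"
      by (rule ip_lincomb_left[OF kernel_mem that])
    also have "(\<lambda>x. ip (K x) g) = g"
      using reproducing[OF that] ip_commute[OF kernel_mem that] by auto
    finally show ?thesis using ip_commute[OF k that] by simp
  qed
  have "(\<lambda>\<nu>. lincomb L (\<lambda>y. lincomb L (\<lambda>x. w \<nu> * \<phi> \<nu> x * \<phi> \<nu> y))) sums lincomb L ?k"
    by (intro sums_lincomb K)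
  also have "(\<lambda>\<nu>. lincomb L (\<lambda>y. lincomb L (\<lambda>x. w \<nu> * \<phi> \<nu> x * \<phi> \<nu> y)))
      = (\<lambda>\<nu>. w \<nu> * (lincomb L (\<phi> \<nu>))\<^sup>2)"
  proof
    fix \<nu>
    have "(\<lambda>y. lincomb L (\<lambda>x. w \<nu> * \<phi> \<nu> x * \<phi> \<nu> y)) = (\<lambda>y. (w \<nu> * lincomb L (\<phi> \<nu>)) * \<phi> \<nu> y)"
      using lincomb_cmult[of L "w \<nu> * \<phi> \<nu> _" "\<phi> \<nu>"] by (simp add: mult_ac flip: lincomb_cmult)
    then show "lincomb L (\<lambda>y. lincomb L (\<lambda>x. w \<nu> * \<phi> \<nu> x * \<phi> \<nu> y)) = w \<nu> * (lincomb L (\<phi> \<nu>))\<^sup>2"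
      by (simp only: lincomb_cmult power2_eq_square mult.assoc)
  qed
  finally have "ip ?k ?k = (\<Sum>\<nu>. w \<nu> * (lincomb L (\<phi> \<nu>))\<^sup>2)"
    using eval[OF k] by (simp add: sums_iff)
  then show "(lincomb L f)\<^sup>2 \<le> ip f f * (\<Sum>\<nu>. w \<nu> * (lincomb L (\<phi> \<nu>))\<^sup>2)"
    using ip_Cauchy_Schwarz[OF f k] eval[OF f] by simp
qed

definition diff_quot :: "real \<Rightarrow> (real \<Rightarrow> real) \<Rightarrow> real \<Rightarrow> real" where
  "diff_quot h g x = (g (x + h) - g x) / h"

text \<open>
  The combination of point evaluations that applies \<open>L\<close> to the difference quotient of step \<open>h\<close>.
\<close>
definition diff_quot_list :: "real \<Rightarrow> (real \<times> real) list \<Rightarrow> (real \<times> real) list" where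
  "diff_quot_list h L = map (\<lambda>(a, x). (a / h, x + h)) L @ map (\<lambda>(a, x). (- a / h, x)) L"

lemma lincomb_diff_quot: "lincomb (diff_quot_list h L) g = lincomb L (diff_quot h g)"
  unfolding diff_quot_list_def lincomb_append
  by (induction L) (auto simp: diff_quot_def divide_inverse algebra_simps)

lemma abs_diff_quot_le:
  assumes g: "\<And>x. (g has_real_derivative g' x) (at x)"
    and B: "\<And>y. \<bar>y\<bar> \<le> \<bar>x\<bar> + 1 \<Longrightarrow> \<bar>g' y\<bar> \<le> B"
    and h: "h \<noteq> 0" "\<bar>h\<bar> \<le> 1"
  shows "\<bar>diff_quot h g x\<bar> \<le> B"
proof -
  have "norm (g (x + h) - g x) \<le> B * norm (x + h - x)"
  proof (rule field_differentiable_bound[of "{- (\<bar>x\<bar> + 1)..\<bar>x\<bar> + 1}" g g'])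
    show "norm (g' z) \<le> B" if "z \<in> {- (\<bar>x\<bar> + 1)..\<bar>x\<bar> + 1}" for z
      using that by (auto intro!: B)
    show "(g has_field_derivative g' z) (at z within {- (\<bar>x\<bar> + 1)..\<bar>x\<bar> + 1})" for z
      using g has_field_derivative_at_within by blast
  qed (use h in auto)
  then show ?thesis using h by (simp add: diff_quot_def field_simps)
qed

text \<open>
  The mean value inequality is used twice: on \<open>g'\<close> to bound its oscillation near \<open>x\<close>, and then on
  \<open>g\<close> minus its linear part at \<open>x\<close>.
\<close>
lemma diff_quot_minus_deriv_le:
  assumes g: "\<And>x. (g has_real_derivative g' x) (at x)"
    and g': "\<And>x. (g' has_real_derivative g'' x) (at x)"
    and B: "\<And>y. \<bar>y\<bar> \<le> \<bar>x\<bar> + 1 \<Longrightarrow> \<bar>g'' y\<bar> \<le> B"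
    and h: "h \<noteq> 0" "\<bar>h\<bar> \<le> 1"
  shows "\<bar>diff_quot h g x - g' x\<bar> \<le> \<bar>h\<bar> * B"
proof -
  let ?S = "cball x \<bar>h\<bar>"
  have S: "\<bar>y\<bar> \<le> \<bar>x\<bar> + 1" if "y \<in> ?S" for y
    using that h by (auto simp: dist_real_def)
  have B0: "0 \<le> B" using B[of x] by linarith
  have 1: "\<bar>g' z - g' x\<bar> \<le> B * \<bar>h\<bar>" if z: "z \<in> ?S" for z
  proof -
    have "norm (g' z - g' x) \<le> B * norm (z - x)"
    proof (rule field_differentiable_bound[of ?S g' g''])
      show "(g' has_field_derivative g'' u) (at u within ?S)" for u
        by (rule has_field_derivative_at_within[OF g'])
      show "norm (g'' u) \<le> B" if "u \<in> ?S" for u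
        using B[OF S[OF that]] by simp
    qed (use z in auto)
    also have "\<dots> \<le> B * \<bar>h\<bar>"
      using z B0 by (intro mult_left_mono) (auto simp: dist_real_def)
    finally show ?thesis by simp
  qed
  have "norm ((g (x + h) - g' x * (x + h)) - (g x - g' x * x)) \<le> (B * \<bar>h\<bar>) * norm (x + h - x)"
  proof (rule field_differentiable_bound[of ?S "\<lambda>z. g z - g' x * z" "\<lambda>z. g' z - g' x"])
    show "((\<lambda>z. g z - g' x * z) has_field_derivative g' z - g' x) (at z within ?S)" for z
      by (rule has_field_derivative_at_within, rule DERIV_cong[OF DERIV_diff[OF g DERIV_cmult[OF DERIV_ident]]]) simp
  qed (use 1 in \<open>auto simp: dist_real_def\<close>)
  moreover have "(g (x + h) - g' x * (x + h)) - (g x - g' x * x) = h * (diff_quot h g x - g' x)"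
    using h by (simp add: diff_quot_def field_simps)
  ultimately have "\<bar>h\<bar> * \<bar>diff_quot h g x - g' x\<bar> \<le> \<bar>h\<bar> * (\<bar>h\<bar> * B)"
    by (simp add: abs_mult mult_ac)
  then show ?thesis using h by simp
qed

text \<open>
  A locally uniform majorant in the weighted sequence space. Applied to the second derivative of the
  feature map it makes difference quotients converge in that space; applied to the first one it
  permits passing to the limit under the sum.
\<close>
definition weighted_bounded :: "(nat \<Rightarrow> real) \<Rightarrow> (nat \<Rightarrow> real \<Rightarrow> real) \<Rightarrow> bool" where
  "weighted_bounded w \<phi> \<longleftrightarrow>
     (\<forall>R. \<exists>B. (\<forall>\<nu> x. \<bar>x\<bar> \<le> R \<longrightarrow> \<bar>\<phi> \<nu> x\<bar> \<le> B \<nu>) \<and> summable (\<lambda>\<nu>. w \<nu> * (B \<nu>)\<^sup>2))"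

lemma weighted_boundedE:
  assumes "weighted_bounded w \<phi>"
  obtains B where "\<And>\<nu> x. \<bar>x\<bar> \<le> R \<Longrightarrow> \<bar>\<phi> \<nu> x\<bar> \<le> B \<nu>" "summable (\<lambda>\<nu>. w \<nu> * (B \<nu>)\<^sup>2)"
  using assms unfolding weighted_bounded_def by meson

text \<open>
  The difference of two difference quotients at \<open>x\<close> is itself a combination of point evaluations, so
  domination bounds it by the corresponding difference for the feature map. The latter is at most
  \<open>\<bar>h\<bar> + \<bar>k\<bar>\<close> times a majorant of the second derivative.
\<close>
lemma dominated_diff_quot_Lipschitz:
  assumes dom: "dominated C w \<phi> f" and C: "0 \<le> C" and w: "\<And>\<nu>. 0 \<le> w \<nu>"
    and D1: "\<And>\<nu> x. (\<phi> \<nu> has_real_derivative \<phi>' \<nu> x) (at x)"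
    and D2: "\<And>\<nu> x. (\<phi>' \<nu> has_real_derivative \<phi>'' \<nu> x) (at x)"
    and bd: "weighted_bounded w \<phi>''"
  shows "\<exists>M\<ge>0. \<forall>h k. h \<noteq> 0 \<longrightarrow> \<bar>h\<bar> \<le> 1 \<longrightarrow> k \<noteq> 0 \<longrightarrow> \<bar>k\<bar> \<le> 1 \<longrightarrow>
           \<bar>diff_quot h f x - diff_quot k f x\<bar> \<le> M * (\<bar>h\<bar> + \<bar>k\<bar>)"
proof -
  obtain B where B: "\<And>\<nu> y. \<bar>y\<bar> \<le> \<bar>x\<bar> + 1 \<Longrightarrow> \<bar>\<phi>'' \<nu> y\<bar> \<le> B \<nu>"
    and sB: "summable (\<lambda>\<nu>. w \<nu> * (B \<nu>)\<^sup>2)"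
    using weighted_boundedE[OF bd] by blast
  define S where "S = (\<Sum>\<nu>. w \<nu> * (B \<nu>)\<^sup>2)"
  have S0: "0 \<le> S" unfolding S_def using w by (intro suminf_nonneg sB) auto
  have "\<bar>diff_quot h f x - diff_quot k f x\<bar> \<le> sqrt (C * S) * (\<bar>h\<bar> + \<bar>k\<bar>)"
    if h: "h \<noteq> 0" "\<bar>h\<bar> \<le> 1" and k: "k \<noteq> 0" "\<bar>k\<bar> \<le> 1" for h k
  proof -
    let ?L = "diff_quot_list h [(1, x)] @ diff_quot_list k [(- 1, x)]"
    have L: "lincomb ?L g = diff_quot h g x - diff_quot k g x" for g
      by (simp add: lincomb_diff_quot)
    have le: "w \<nu> * (lincomb ?L (\<phi> \<nu>))\<^sup>2 \<le> (\<bar>h\<bar> + \<bar>k\<bar>)\<^sup>2 * (w \<nu> * (B \<nu>)\<^sup>2)" for \<nu>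
    proof -
      have "\<bar>diff_quot h (\<phi> \<nu>) x - \<phi>' \<nu> x\<bar> \<le> \<bar>h\<bar> * B \<nu>"
        by (rule diff_quot_minus_deriv_le[OF D1 D2 B h])
      moreover have "\<bar>diff_quot k (\<phi> \<nu>) x - \<phi>' \<nu> x\<bar> \<le> \<bar>k\<bar> * B \<nu>"
        by (rule diff_quot_minus_deriv_le[OF D1 D2 B k])
      ultimately have "\<bar>lincomb ?L (\<phi> \<nu>)\<bar> \<le> (\<bar>h\<bar> + \<bar>k\<bar>) * B \<nu>"
        unfolding L distrib_right by linarith
      then have "\<bar>lincomb ?L (\<phi> \<nu>)\<bar>\<^sup>2 \<le> ((\<bar>h\<bar> + \<bar>k\<bar>) * B \<nu>)\<^sup>2"
        by (rule power_mono) (rule abs_ge_zero)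
      then have "w \<nu> * (lincomb ?L (\<phi> \<nu>))\<^sup>2 \<le> w \<nu> * ((\<bar>h\<bar> + \<bar>k\<bar>) * B \<nu>)\<^sup>2"
        unfolding power2_abs by (rule mult_left_mono[OF _ w])
      then show ?thesis by (simp only: power_mult_distrib mult.left_commute)
    qed
    have "(\<Sum>\<nu>. w \<nu> * (lincomb ?L (\<phi> \<nu>))\<^sup>2) \<le> (\<Sum>\<nu>. (\<bar>h\<bar> + \<bar>k\<bar>)\<^sup>2 * (w \<nu> * (B \<nu>)\<^sup>2))"
    proof (rule suminf_le[OF le])
      show "summable (\<lambda>\<nu>. w \<nu> * (lincomb ?L (\<phi> \<nu>))\<^sup>2)"
        by (rule summable_comparison_test'[OF summable_mult[OF sB]]) (use w le in auto)
    qed (intro summable_mult sB)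
    also have "\<dots> = (\<bar>h\<bar> + \<bar>k\<bar>)\<^sup>2 * S"
      unfolding S_def by (rule suminf_mult[OF sB])
    finally have "(lincomb ?L f)\<^sup>2 \<le> C * ((\<bar>h\<bar> + \<bar>k\<bar>)\<^sup>2 * S)"
      using dom C unfolding dominated_def by (meson mult_left_mono order_trans)
    then have "\<bar>lincomb ?L f\<bar> \<le> sqrt (C * ((\<bar>h\<bar> + \<bar>k\<bar>)\<^sup>2 * S))"
      by (metis real_sqrt_abs real_sqrt_le_mono)
    also have "\<dots> = sqrt (C * S) * (\<bar>h\<bar> + \<bar>k\<bar>)"
      by (simp add: real_sqrt_mult mult_ac)
    finally show ?thesis unfolding L .
  qed
  moreover have "0 \<le> sqrt (C * S)" using C S0 by simp
  ultimately show ?thesis by blast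
qed

text \<open>
  The difference quotients form a Cauchy family as the step tends to zero; completeness of the reals
  provides the limit along one null sequence, and the estimate extends it to all steps.
\<close>
lemma has_derivative_if_diff_quot_Lipschitz:
  assumes M: "\<And>h k. h \<noteq> 0 \<Longrightarrow> \<bar>h\<bar> \<le> 1 \<Longrightarrow> k \<noteq> 0 \<Longrightarrow> \<bar>k\<bar> \<le> 1 \<Longrightarrow>
           \<bar>diff_quot h f x - diff_quot k f x\<bar> \<le> M * (\<bar>h\<bar> + \<bar>k\<bar>)"
    and M0: "0 \<le> M"
  shows "\<exists>d. (f has_real_derivative d) (at x)"
proof -
  define s where "s n = inverse (real (Suc n))" for n
  define X where "X n = diff_quot (s n) f x" for n
  have s: "s n \<noteq> 0" "\<bar>s n\<bar> \<le> 1" for n by (simp_all add: s_def inverse_le_1_iff)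
  have s0: "s \<longlonglongrightarrow> 0" unfolding s_def by (rule LIMSEQ_inverse_real_of_nat)
  have "Cauchy X"
  proof (rule metric_CauchyI)
    fix e :: real assume e: "0 < e"
    have "(\<lambda>n. M * \<bar>s n\<bar>) \<longlonglongrightarrow> M * \<bar>0\<bar>" by (intro tendsto_intros s0)
    then have "\<forall>\<^sub>F n in sequentially. M * \<bar>s n\<bar> < e / 2"
      using order_tendstoD(2)[of _ 0 sequentially "e / 2"] e by simp
    then obtain N where N: "M * \<bar>s n\<bar> < e / 2" if "n \<ge> N" for n
      unfolding eventually_sequentially by blast
    have "dist (X m) (X n) < e" if "m \<ge> N" "n \<ge> N" for m n
      using M[OF s s, of m n] N[OF that(1)] N[OF that(2)]
      by (simp add: X_def dist_real_def distrib_left)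
    then show "\<exists>N. \<forall>m\<ge>N. \<forall>n\<ge>N. dist (X m) (X n) < e" by blast
  qed
  then obtain d where d: "X \<longlonglongrightarrow> d"
    using Cauchy_convergent unfolding convergent_def by blast
  have le: "\<bar>diff_quot h f x - d\<bar> \<le> M * \<bar>h\<bar>" if h: "h \<noteq> 0" "\<bar>h\<bar> \<le> 1" for h
  proof (rule LIMSEQ_le)
    show "(\<lambda>n. \<bar>diff_quot h f x - X n\<bar>) \<longlonglongrightarrow> \<bar>diff_quot h f x - d\<bar>"
      by (intro tendsto_intros d)
    have "(\<lambda>n. M * (\<bar>h\<bar> + \<bar>s n\<bar>)) \<longlonglongrightarrow> M * (\<bar>h\<bar> + \<bar>0\<bar>)" by (intro tendsto_intros s0)
    then show "(\<lambda>n. M * (\<bar>h\<bar> + \<bar>s n\<bar>)) \<longlonglongrightarrow> M * \<bar>h\<bar>" by simp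
    show "\<exists>N. \<forall>n\<ge>N. \<bar>diff_quot h f x - X n\<bar> \<le> M * (\<bar>h\<bar> + \<bar>s n\<bar>)"
      unfolding X_def using M[OF h s] by blast
  qed
  have "((\<lambda>h. diff_quot h f x - d) \<longlongrightarrow> 0) (at 0)"
  proof (rule Lim_null_comparison)
    show "\<forall>\<^sub>F h in at 0. norm (diff_quot h f x - d) \<le> M * \<bar>h\<bar>"
      unfolding eventually_at by (rule exI[of _ 1]) (auto intro!: le)
    have "((\<lambda>h. M * \<bar>h\<bar>) \<longlongrightarrow> M * \<bar>0\<bar>) (at 0)" by (intro tendsto_intros)
    then show "((\<lambda>h. M * \<bar>h\<bar>) \<longlongrightarrow> 0) (at 0)" by simp
  qed
  then have "(f has_real_derivative d) (at x)"
    unfolding DERIV_def diff_quot_def by (rule LIM_zero_cancel)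
  then show ?thesis by blast
qed

text \<open>
  Replace every point evaluation by a difference quotient and let the step tend to zero. On the right-hand
  side the limit is interchanged with the sum by Tannery's theorem.
\<close>
lemma dominated_derivative:
  assumes dom: "dominated C w \<phi> f" and C: "0 \<le> C" and w: "\<And>\<nu>. 0 \<le> w \<nu>"
    and D1: "\<And>\<nu> x. (\<phi> \<nu> has_real_derivative \<phi>' \<nu> x) (at x)"
    and f': "\<And>x. (f has_real_derivative f' x) (at x)"
    and bd: "weighted_bounded w \<phi>'"
  shows "dominated C w \<phi>' f'"
  unfolding dominated_def
proof
  fix L :: "(real \<times> real) list"
  define s where "s n = inverse (real (Suc n))" for n
  have s: "s n \<noteq> 0" "\<bar>s n\<bar> \<le> 1" for n by (simp_all add: s_def inverse_le_1_iff)
  have s0: "filterlim s (at 0) sequentially"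
    unfolding filterlim_at s_def using LIMSEQ_inverse_real_of_nat by auto
  have lim: "(\<lambda>n. lincomb L (diff_quot (s n) g)) \<longlonglongrightarrow> lincomb L g'"
    if "\<And>x. (g has_real_derivative g' x) (at x)" for g g'
    by (rule tendsto_lincomb, rule filterlim_compose[OF _ s0])
       (use that in \<open>simp add: DERIV_def diff_quot_def\<close>)
  obtain R where R: "\<And>a x. (a, x) \<in> set L \<Longrightarrow> \<bar>x\<bar> \<le> R"
  proof
    show "\<bar>x\<bar> \<le> Max (abs ` snd ` set L)" if "(a, x) \<in> set L" for a x
      using that by (intro Max_ge) force+
  qed
  obtain B where B: "\<And>\<nu> y. \<bar>y\<bar> \<le> R + 1 \<Longrightarrow> \<bar>\<phi>' \<nu> y\<bar> \<le> B \<nu>"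
    and sB: "summable (\<lambda>\<nu>. w \<nu> * (B \<nu>)\<^sup>2)"
    using weighted_boundedE[OF bd] by blast
  define A where "A = (\<Sum>(a, x)\<leftarrow>L. \<bar>a\<bar>)"
  have bound: "\<bar>lincomb L (diff_quot (s n) (\<phi> \<nu>))\<bar> \<le> A * B \<nu>" for n \<nu>
    unfolding A_def
  proof (rule abs_lincomb_le)
    fix a x assume "(a, x) \<in> set L"
    then show "\<bar>diff_quot (s n) (\<phi> \<nu>) x\<bar> \<le> B \<nu>"
      using R by (intro abs_diff_quot_le[OF D1 _ s] B) force
  qed
  have "eventually (\<lambda>n. summable (\<lambda>\<nu>. norm (w \<nu> * (lincomb L (diff_quot (s n) (\<phi> \<nu>)))\<^sup>2))) sequentially \<and>
      summable (\<lambda>\<nu>. norm (w \<nu> * (lincomb L (\<phi>' \<nu>))\<^sup>2)) \<and>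
      (\<lambda>n. \<Sum>\<nu>. w \<nu> * (lincomb L (diff_quot (s n) (\<phi> \<nu>)))\<^sup>2)
      \<longlonglongrightarrow> (\<Sum>\<nu>. w \<nu> * (lincomb L (\<phi>' \<nu>))\<^sup>2)"
  proof (rule tannerys_theorem)
    show "summable (\<lambda>\<nu>. A\<^sup>2 * (w \<nu> * (B \<nu>)\<^sup>2))" by (intro summable_mult sB)
    show "(\<lambda>n. w \<nu> * (lincomb L (diff_quot (s n) (\<phi> \<nu>)))\<^sup>2) \<longlonglongrightarrow> w \<nu> * (lincomb L (\<phi>' \<nu>))\<^sup>2" for \<nu>
      by (intro tendsto_intros lim D1)
    have "norm (w \<nu> * (lincomb L (diff_quot (s n) (\<phi> \<nu>)))\<^sup>2) \<le> A\<^sup>2 * (w \<nu> * (B \<nu>)\<^sup>2)" for \<nu> n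
    proof -
      have "\<bar>lincomb L (diff_quot (s n) (\<phi> \<nu>))\<bar>\<^sup>2 \<le> (A * B \<nu>)\<^sup>2"
        by (rule power_mono[OF bound]) (rule abs_ge_zero)
      then have "w \<nu> * (lincomb L (diff_quot (s n) (\<phi> \<nu>)))\<^sup>2 \<le> w \<nu> * (A * B \<nu>)\<^sup>2"
        unfolding power2_abs by (rule mult_left_mono[OF _ w])
      then show ?thesis
        using w[of \<nu>] by (simp add: power_mult_distrib mult.left_commute)
    qed
    then show "\<forall>\<^sub>F (\<nu>, n) in at_top \<times>\<^sub>F sequentially.
        norm (w \<nu> * (lincomb L (diff_quot (s n) (\<phi> \<nu>)))\<^sup>2) \<le> A\<^sup>2 * (w \<nu> * (B \<nu>)\<^sup>2)"
      by (intro always_eventually) auto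
  qed simp
  then have lim_w: "(\<lambda>n. C * (\<Sum>\<nu>. w \<nu> * (lincomb L (diff_quot (s n) (\<phi> \<nu>)))\<^sup>2))
      \<longlonglongrightarrow> C * (\<Sum>\<nu>. w \<nu> * (lincomb L (\<phi>' \<nu>))\<^sup>2)"
    by (intro tendsto_intros) auto
  show "(lincomb L f')\<^sup>2 \<le> C * (\<Sum>\<nu>. w \<nu> * (lincomb L (\<phi>' \<nu>))\<^sup>2)"
  proof (rule LIMSEQ_le[OF _ lim_w])
    show "(\<lambda>n. (lincomb L (diff_quot (s n) f))\<^sup>2) \<longlonglongrightarrow> (lincomb L f')\<^sup>2"
      by (intro tendsto_intros lim f')
    have "(lincomb L (diff_quot (s n) f))\<^sup>2
        \<le> C * (\<Sum>\<nu>. w \<nu> * (lincomb L (diff_quot (s n) (\<phi> \<nu>)))\<^sup>2)" for n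
      using dom unfolding dominated_def
      by (metis (no_types, lifting) lincomb_diff_quot suminf_cong)
    then show "\<exists>N. \<forall>n\<ge>N. (lincomb L (diff_quot (s n) f))\<^sup>2
        \<le> C * (\<Sum>\<nu>. w \<nu> * (lincomb L (diff_quot (s n) (\<phi> \<nu>)))\<^sup>2)" by blast
  qed
qed

text \<open>
  Induction on the order, with both parts in one step: the domination reached so far yields the next
  derivative, which is then dominated by the next derivative of the features. The constant
  \<open>C\<close> does not change along the induction, so the growth of the derivatives of \<open>f\<close> is governed by the
  features alone.
\<close>
lemma dominated_higher_derivatives:
  assumes dom: "dominated C w (\<phi> 0) f" and C: "0 \<le> C" and w: "\<And>\<nu>. 0 \<le> w \<nu>"
    and D: "\<And>l \<nu> x. (\<phi> l \<nu> has_real_derivative \<phi> (Suc l) \<nu> x) (at x)"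
    and bd: "\<And>l. weighted_bounded w (\<phi> l)"
  shows "dominated C w (\<phi> l) ((deriv ^^ l) f)"
    and "((deriv ^^ l) f has_real_derivative (deriv ^^ Suc l) f x) (at x)"
proof -
  have step: "(g has_real_derivative deriv g x) (at x)" if dom_g: "dominated C w (\<phi> l) g" for g l x
  proof -
    obtain M where "0 \<le> M" and "\<forall>h k. h \<noteq> 0 \<longrightarrow> \<bar>h\<bar> \<le> 1 \<longrightarrow> k \<noteq> 0 \<longrightarrow> \<bar>k\<bar> \<le> 1 \<longrightarrow>
        \<bar>diff_quot h g x - diff_quot k g x\<bar> \<le> M * (\<bar>h\<bar> + \<bar>k\<bar>)"
      using dominated_diff_quot_Lipschitz[OF dom_g C w D D bd] by blast
    then obtain d where "(g has_real_derivative d) (at x)"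
      using has_derivative_if_diff_quot_Lipschitz[of g x M] by blast
    then show ?thesis by (simp add: DERIV_imp_deriv)
  qed
  have all: "dominated C w (\<phi> l) ((deriv ^^ l) f)" for l
  proof (induction l)
    case 0
    show ?case using dom by simp
  next
    case (Suc l)
    show ?case using dominated_derivative[OF Suc C w D step[OF Suc] bd] by simp
  qed
  show "dominated C w (\<phi> l) ((deriv ^^ l) f)" by (rule all)
  show "((deriv ^^ l) f has_real_derivative (deriv ^^ Suc l) f x) (at x)"
    using step[OF all] by simp
qed

section \<open>Analyticity from factorial derivative bounds\<close>
lemma real_analytic_if_deriv_bound:
  assumes D: "\<And>l x. ((deriv ^^ l) f has_real_derivative (deriv ^^ Suc l) f x) (at x)"
    and bound: "\<And>R. R > 0 \<Longrightarrow> \<exists>c>0. \<forall>l. \<forall>x\<in>{- R..R}. \<bar>(deriv ^^ l) f x\<bar> \<le> c ^ (l + 1) * fact l"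
  shows "real_analytic f"
  unfolding real_analytic_def
proof
  fix x :: real
  have "0 < \<bar>x\<bar> + 1" by simp
  from bound[OF this] obtain c where c: "c > 0"
    and cb: "\<forall>l. \<forall>y\<in>{- (\<bar>x\<bar> + 1)..\<bar>x\<bar> + 1}. \<bar>(deriv ^^ l) f y\<bar> \<le> c ^ (l + 1) * fact l"
    by blast
  define a where "a n = (deriv ^^ n) f x / fact n" for n
  \<comment> \<open>Within this radius the Taylor remainder of order \<open>n\<close> is at most \<open>c / 2 ^ n\<close>, and all intermediate points stay in the interval on which \<open>c\<close> is valid.\<close>
  define \<delta> where "\<delta> = min 1 (1 / (2 * c))"
  have \<delta>: "\<delta> > 0" "\<delta> \<le> 1" "c * \<delta> \<le> 1 / 2"
  proof -
    show "\<delta> > 0" "\<delta> \<le> 1" using c by (simp_all add: \<delta>_def)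
    have "c * \<delta> \<le> c * (1 / (2 * c))" using c by (intro mult_left_mono) (simp_all add: \<delta>_def)
    then show "c * \<delta> \<le> 1 / 2" using c by simp
  qed
  have sums: "(\<lambda>n. a n * z ^ n) sums f (x + z)" if z: "\<bar>z\<bar> \<le> \<delta>" for z
  proof -
    have rem: "\<bar>f (x + z) - (\<Sum>m<n. a m * z ^ m)\<bar> \<le> c * (1 / 2) ^ n" for n
    proof -
      have "\<forall>m t. ((\<lambda>t. (deriv ^^ m) f (x + t)) has_real_derivative (deriv ^^ Suc m) f (x + t)) (at t)"
      proof (intro allI)
        fix m t
        show "((\<lambda>t. (deriv ^^ m) f (x + t)) has_real_derivative (deriv ^^ Suc m) f (x + t)) (at t)"
          using iffD1[OF DERIV_shift D[of m "t + x"]] by (simp only: add.commute[of x])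
      qed
      then obtain t where t: "\<bar>t\<bar> \<le> \<bar>z\<bar>" and
        eq: "f (x + z) = (\<Sum>m<n. ((deriv ^^ m) f (x + 0) / fact m) * z ^ m)
               + ((deriv ^^ n) f (x + t) / fact n) * z ^ n"
        using Maclaurin_all_le[of "\<lambda>m t. (deriv ^^ m) f (x + t)" "\<lambda>t. f (x + t)" z n] by auto
      have "\<bar>(deriv ^^ n) f (x + t)\<bar> \<le> c ^ (n + 1) * fact n"
        using t z \<delta> by (intro cb[rule_format]) auto
      then have "\<bar>((deriv ^^ n) f (x + t) / fact n)\<bar> \<le> c ^ (n + 1)"
        by (simp add: field_simps abs_divide)
      then have "\<bar>((deriv ^^ n) f (x + t) / fact n) * z ^ n\<bar> \<le> c ^ (n + 1) * \<delta> ^ n"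
        unfolding abs_mult power_abs using z c by (intro mult_mono power_mono) auto
      also have "\<dots> = c * (c * \<delta>) ^ n" by (simp add: power_mult_distrib)
      also have "\<dots> \<le> c * (1 / 2) ^ n"
        using c \<delta> by (intro mult_left_mono power_mono) auto
      finally show ?thesis using eq by (simp add: a_def)
    qed
    have "(\<lambda>n. f (x + z) - (\<Sum>m<n. a m * z ^ m)) \<longlonglongrightarrow> 0"
    proof (rule Lim_null_comparison)
      show "\<forall>\<^sub>F n in sequentially. norm (f (x + z) - (\<Sum>m<n. a m * z ^ m)) \<le> c * (1 / 2) ^ n"
        using rem by simp
      have "(\<lambda>n. c * (1 / 2) ^ n) \<longlonglongrightarrow> c * 0"
        by (intro tendsto_intros LIMSEQ_realpow_zero) auto
      then show "(\<lambda>n. c * (1 / 2) ^ n) \<longlonglongrightarrow> 0" by simp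
    qed
    then show ?thesis
      unfolding sums_def using tendsto_diff[OF tendsto_const[of "f (x + z)"]] by fastforce
  qed
  have "(\<lambda>t. f (x + t)) has_fps_expansion Abs_fps a"
    unfolding has_fps_expansion_def
  proof
    have "summable (\<lambda>n. fps_nth (Abs_fps a) n * \<delta> ^ n)"
      using sums[of \<delta>] \<delta> by (auto simp: sums_iff)
    then have "ereal (norm \<delta>) \<le> fps_conv_radius (Abs_fps a)"
      unfolding fps_conv_radius_def by (rule conv_radius_geI)
    then show "fps_conv_radius (Abs_fps a) > 0"
      using \<delta> by (metis ereal_less(2) less_le_trans abs_of_pos real_norm_def)
    have "eval_fps (Abs_fps a) z = f (x + z)" if "dist z 0 < \<delta>" for z
      using sums[of z] that by (auto simp: eval_fps_def sums_iff)
    then show "\<forall>\<^sub>F z in nhds 0. eval_fps (Abs_fps a) z = f (x + z)"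
      unfolding eventually_nhds_metric using \<delta> by blast
  qed
  then show "\<exists>F. (\<lambda>t. f (x + t)) has_fps_expansion F" by blast
qed

section \<open>Power sums against the weights\<close>
lemma power_le_fact_mult_exp:
  fixes x :: real
  assumes "0 \<le> x"
  shows "x ^ l \<le> fact l * exp x"
proof -
  have "(\<Sum>n\<in>{l}. x ^ n /\<^sub>R fact n) \<le> exp x"
    unfolding exp_def using assms by (intro sum_le_suminf summable_exp_generic) auto
  then show ?thesis by (simp add: field_simps)
qed

text \<open>
  Apply \<open>x ^ l \<le> fact l * exp x\<close> to \<open>x = b * \<rho> * n powr b\<close> and take the power \<open>1 / b\<close>: the factor
  \<open>b\<close> in \<open>x\<close> is chosen so that the exponential becomes \<open>exp (\<rho> * n powr b)\<close>. This is where the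
  power \<open>1 / b\<close> of the factorial originates.
\<close>
lemma power_le_gevrey_factor:
  fixes b \<rho> :: real
  assumes b: "0 < b" and \<rho>: "0 < \<rho>"
  shows "real n ^ l \<le> ((b * \<rho>) powr - (1 / b)) ^ l * fact l powr (1 / b) * exp (\<rho> * real n powr b)"
proof (cases "n = 0")
  case True
  then show ?thesis by (cases "l = 0") (simp_all add: zero_power)
next
  case False
  define t where "t = real n powr b"
  have "((b * \<rho> * t) ^ l) powr (1 / b) \<le> (fact l * exp (b * \<rho> * t)) powr (1 / b)"
    using b \<rho> by (intro powr_mono2 power_le_fact_mult_exp) (auto simp: t_def)
  also have "\<dots> = fact l powr (1 / b) * exp (\<rho> * t)"
    using b by (simp add: powr_mult exp_powr_real)
  also have "((b * \<rho> * t) ^ l) powr (1 / b) = ((b * \<rho>) powr (1 / b)) ^ l * (t powr (1 / b)) ^ l"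
    using b \<rho> False
    by (simp add: t_def powr_mult power_mult_distrib powr_powr flip: powr_realpow powr_power)
  also have "t powr (1 / b) = real n"
    using b by (simp add: t_def powr_powr)
  finally show ?thesis
    using b \<rho> by (simp add: t_def powr_minus power_inverse field_simps)
qed

text \<open>
  The preceding estimate with \<open>l = 2\<close> is a comparison with the series of inverse squares.
\<close>
lemma summable_exp_minus_powr:
  fixes b \<rho> :: real
  assumes b: "0 < b" and \<rho>: "0 < \<rho>"
  shows "summable (\<lambda>n. exp (- \<rho> * real n powr b))"
proof -
  define K where "K = ((b * \<rho>) powr - (1 / b)) ^ 2 * fact 2 powr (1 / b)"
  have le: "norm (exp (- \<rho> * real n powr b)) \<le> K * inverse (real n ^ 2)" if "n \<ge> 1" for n
  proof -
    have "real n ^ 2 \<le> K * exp (\<rho> * real n powr b)"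
      using power_le_gevrey_factor[OF b \<rho>, of n 2] by (simp add: K_def)
    then show ?thesis using that by (simp add: exp_minus field_simps)
  qed
  have "summable (\<lambda>n. K * inverse (real n ^ 2))"
    by (intro summable_mult inverse_power_summable) simp
  then show ?thesis by (rule summable_comparison_test'[OF _ le])
qed

context
  fixes r b :: real
  assumes r: "0 < r" and b: "0 < b"
begin

text \<open>
  Half of the exponential decay rate of \<open>1 / \<alpha>\<^sub>\<nu>\<close> in terms of \<open>\<nu> powr b\<close>, so that the weight is the square of
  \<open>exp (- rate * \<nu> powr b)\<close> and its two factors can be spent separately.
\<close>
definition rate where "rate = r * ln 2 / 2"

lemma rate_pos: "0 < rate"
  using r by (simp add: rate_def)

lemma inverse_alpha_eq: "inverse (alpha r b n) = exp (- rate * real n powr b) * exp (- rate * real n powr b)"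
  by (simp add: alpha_def rate_def powr_def[of 2] flip: exp_minus exp_add)

lemma weighted_power_le:
  "inverse (alpha r b n) * (real n ^ l * E)
     \<le> ((b * rate) powr - (1 / b)) ^ l * fact l powr (1 / b) * E * exp (- rate * real n powr b)"
  if "0 \<le> E"
proof -
  let ?e = "exp (- rate * real n powr b)" and ?G = "((b * rate) powr - (1 / b)) ^ l * fact l powr (1 / b)"
  have "real n ^ l * ?e \<le> ?G * exp (rate * real n powr b) * ?e"
    by (intro mult_right_mono power_le_gevrey_factor b rate_pos) simp
  also have "\<dots> = ?G" by (simp add: exp_minus)
  finally have "(real n ^ l * ?e) * (E * ?e) \<le> ?G * (E * ?e)"
    using that by (intro mult_right_mono) auto
  then show ?thesis unfolding inverse_alpha_eq by (simp only: mult_ac)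
qed

lemma inverse_alpha_nonneg: "0 \<le> inverse (alpha r b n)"
  by (simp add: inverse_alpha_eq)

lemma summable_weighted_power:
  assumes "0 \<le> E"
  shows "summable (\<lambda>n. inverse (alpha r b n) * (real n ^ l * E))"
  by (rule summable_comparison_test'[OF summable_mult[OF summable_exp_minus_powr[OF b rate_pos]]])
     (use weighted_power_le[OF assms] inverse_alpha_nonneg assms in auto)

lemma weighted_bounded_hermite_deriv:
  "weighted_bounded (\<lambda>n. inverse (alpha r b n)) (hermite_deriv l)"
  unfolding weighted_bounded_def
proof
  fix R :: real
  let ?B = "\<lambda>n. sqrt (real n ^ l * exp (R\<^sup>2))"
  have "\<bar>hermite_deriv l n x\<bar> \<le> ?B n" if "\<bar>x\<bar> \<le> R" for n x
  proof (rule real_le_rsqrt)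
    have "x\<^sup>2 \<le> R\<^sup>2" using that power_mono[of "\<bar>x\<bar>" R 2] by simp
    then have "real n ^ l * exp (x\<^sup>2) \<le> real n ^ l * exp (R\<^sup>2)" by (intro mult_left_mono) auto
    then show "\<bar>hermite_deriv l n x\<bar>\<^sup>2 \<le> real n ^ l * exp (R\<^sup>2)"
      using hermite_deriv_sq_le[of l n x] by simp
  qed
  moreover have "summable (\<lambda>n. inverse (alpha r b n) * (?B n)\<^sup>2)"
    using summable_weighted_power[of "exp (R\<^sup>2)" l] by simp
  ultimately show "\<exists>B. (\<forall>n x. \<bar>x\<bar> \<le> R \<longrightarrow> \<bar>hermite_deriv l n x\<bar> \<le> B n) \<and>
      summable (\<lambda>n. inverse (alpha r b n) * (B n)\<^sup>2)"
    by (intro exI[of _ ?B]) blast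
qed

text \<open>
  Here the convergence of the kernel series is established, without which the infinite sum
  defining the kernel would say nothing. Features are written as derivatives of order zero to start
  the induction over the order.
\<close>
lemma hermite_kernel_sums:
  "(\<lambda>n. inverse (alpha r b n) * hermite_deriv 0 n x * hermite_deriv 0 n y) sums hermite_kernel r b x y"
proof -
  let ?E = "exp (x\<^sup>2) + exp (y\<^sup>2)"
  have "\<bar>hermite n x * hermite n y\<bar> \<le> ?E" for n
  proof -
    have "2 * (\<bar>hermite n x\<bar> * \<bar>hermite n y\<bar>) \<le> (hermite n x)\<^sup>2 + (hermite n y)\<^sup>2"
      using sum_squares_bound[of "\<bar>hermite n x\<bar>" "\<bar>hermite n y\<bar>"] by simp
    then show ?thesis
      using hermite_sq_le[of n x] hermite_sq_le[of n y] zero_le_power2[of "hermite n x"]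
        zero_le_power2[of "hermite n y"] unfolding abs_mult by linarith
  qed
  then have "norm (inverse (alpha r b n) * hermite n x * hermite n y)
      \<le> inverse (alpha r b n) * (real n ^ 0 * ?E)" for n
    using inverse_alpha_nonneg[of n]
    by (simp only: real_norm_def abs_mult mult.assoc abs_of_nonneg power_0 mult_1) (intro mult_left_mono, auto)
  then have "summable (\<lambda>n. inverse (alpha r b n) * hermite n x * hermite n y)"
    by (intro summable_comparison_test'[OF summable_weighted_power[of ?E 0]]) auto
  then show ?thesis
    by (simp add: hermite_deriv_def hermite_kernel_def summable_sums)
qed

lemma suminf_hermite_deriv_le:
  "(\<Sum>n. inverse (alpha r b n) * (hermite_deriv l n x)\<^sup>2)
     \<le> exp (x\<^sup>2) * (\<Sum>n. exp (- rate * real n powr b))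
         * ((b * rate) powr - (1 / b)) ^ l * fact l powr (1 / b)"
proof -
  let ?G = "((b * rate) powr - (1 / b)) ^ l * fact l powr (1 / b)"
  have le: "inverse (alpha r b n) * (hermite_deriv l n x)\<^sup>2 \<le> inverse (alpha r b n) * (real n ^ l * exp (x\<^sup>2))" for n
    by (intro mult_left_mono hermite_deriv_sq_le inverse_alpha_nonneg)
  have S: "summable (\<lambda>n. inverse (alpha r b n) * (real n ^ l * exp (x\<^sup>2)))"
    by (rule summable_weighted_power) simp
  note E = summable_exp_minus_powr[OF b rate_pos]
  have "(\<Sum>n. inverse (alpha r b n) * (hermite_deriv l n x)\<^sup>2)
      \<le> (\<Sum>n. inverse (alpha r b n) * (real n ^ l * exp (x\<^sup>2)))"
    by (rule suminf_le[OF le summable_comparison_test'[OF S] S]) (use le inverse_alpha_nonneg in auto)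
  also have "\<dots> \<le> (\<Sum>n. (?G * exp (x\<^sup>2)) * exp (- rate * real n powr b))"
    by (rule suminf_le[OF _ S summable_mult[OF E]]) (rule weighted_power_le, simp)
  also have "\<dots> = (?G * exp (x\<^sup>2)) * (\<Sum>n. exp (- rate * real n powr b))"
    by (rule suminf_mult[OF E])
  finally show ?thesis by (simp only: mult_ac)
qed

end

section \<open>Gevrey regularity\<close>
text \<open>
  The constants \<open>M\<close> and \<open>q\<close> are absorbed into one \<open>c \<ge> 1\<close>. For such \<open>c\<close>, and likewise
  for the factorial, raising the exponent to \<open>2 * \<sigma>\<close> only enlarges the bound, which turns it into a
  perfect square.
\<close>
lemma gevreyI_square_bound:
  fixes s \<sigma> :: real
  assumes D: "\<And>l x. ((deriv ^^ l) f has_real_derivative (deriv ^^ Suc l) f x) (at x)"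
    and bound: "\<And>R. \<exists>M q. \<forall>l x. \<bar>x\<bar> \<le> R \<longrightarrow> ((deriv ^^ l) f x)\<^sup>2 \<le> M * q ^ l * fact l powr s"
    and \<sigma>: "1 \<le> \<sigma>" "s \<le> 2 * \<sigma>"
  shows "f \<in> gevrey \<sigma>"
  unfolding gevrey_def
proof (intro CollectI conjI allI impI)
  show "(deriv ^^ l) f differentiable (at x)" for l x
    using D real_differentiable_def by blast
  fix R :: real
  obtain M q where Mq: "\<And>l x. \<bar>x\<bar> \<le> R \<Longrightarrow> ((deriv ^^ l) f x)\<^sup>2 \<le> M * q ^ l * fact l powr s"
    using bound by metis
  define c where "c = max 1 \<bar>M\<bar> * max 1 \<bar>q\<bar>"
  have c1: "\<bar>M\<bar> \<le> c" "\<bar>q\<bar> \<le> c" "1 \<le> c"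
    unfolding c_def
    using mult_mono[of "\<bar>M\<bar>" "max 1 \<bar>M\<bar>" 1 "max 1 \<bar>q\<bar>"] mult_mono[of 1 "max 1 \<bar>M\<bar>" "\<bar>q\<bar>" "max 1 \<bar>q\<bar>"]
      mult_mono[of 1 "max 1 \<bar>M\<bar>" 1 "max 1 \<bar>q\<bar>"] by auto
  have "\<bar>(deriv ^^ l) f x\<bar> \<le> (c ^ (l + 1) * fact l) powr \<sigma>" if x: "x \<in> {- R..R}" for l x
  proof -
    have c2: "1 \<le> c ^ (l + 1)" by (rule one_le_power[OF c1(3)])
    have "M * q ^ l \<le> \<bar>M\<bar> * \<bar>q\<bar> ^ l"
      by (metis abs_ge_self abs_mult power_abs)
    also have "\<dots> \<le> c * c ^ l"
      using c1 by (intro mult_mono power_mono) auto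
    also have "\<dots> = (c ^ (l + 1)) powr 1" using c1 by simp
    also have "\<dots> \<le> (c ^ (l + 1)) powr (2 * \<sigma>)"
      by (rule powr_mono[OF _ c2]) (use \<sigma> in simp)
    finally have 1: "M * q ^ l \<le> (c ^ (l + 1)) powr (2 * \<sigma>)" .
    have 2: "fact l powr s \<le> fact l powr (2 * \<sigma>)"
      by (rule powr_mono[OF \<sigma>(2) fact_ge_1])
    have "((deriv ^^ l) f x)\<^sup>2 \<le> M * q ^ l * fact l powr s"
      using x by (intro Mq) auto
    also have "\<dots> \<le> (c ^ (l + 1)) powr (2 * \<sigma>) * fact l powr (2 * \<sigma>)"
      by (intro mult_mono 1 2) auto
    also have "\<dots> = (c ^ (l + 1) * fact l) powr (2 * \<sigma>)"
      using c1 by (subst powr_mult) auto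
    also have "\<dots> = ((c ^ (l + 1) * fact l) powr \<sigma>)\<^sup>2"
      by (simp add: power2_eq_square flip: powr_add)
    finally show ?thesis by (metis abs_le_square_iff abs_of_nonneg powr_ge_zero)
  qed
  then show "\<exists>c>0. \<forall>l. \<forall>x\<in>{- R..R}. \<bar>(deriv ^^ l) f x\<bar> \<le> (c ^ (l + 1) * fact l) powr \<sigma>"
    using c1 by (intro exI[of _ c]) auto
qed

theorem lemma3p7:
  fixes r b \<sigma> :: real
    and H :: "(real \<Rightarrow> real) set"
    and ip :: "(real \<Rightarrow> real) \<Rightarrow> (real \<Rightarrow> real) \<Rightarrow> real"
  assumes "r > 0" and "b > 0"
    and "\<sigma> = max 1 (1 / (2 * b))"
    and "rkhs H ip (hermite_kernel r b)"
  shows "H \<subseteq> gevrey \<sigma> \<and> (b \<ge> 1 / 2 \<longrightarrow> (\<forall>f\<in>H. real_analytic f))"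
proof -
  interpret rkhs H ip "hermite_kernel r b" by fact
  let ?w = "\<lambda>n. inverse (alpha r b n)"
  let ?A = "\<Sum>n. exp (- rate r * real n powr b)"
  let ?q = "(b * rate r) powr - (1 / b)"
  have dom: "dominated (ip f f) ?w (hermite_deriv 0) f" if "f \<in> H" for f
    using that by (intro dominated_by_features hermite_kernel_sums assms)
  note higher = dominated_higher_derivatives[OF dom ip_nonneg inverse_alpha_nonneg
      DERIV_hermite_deriv weighted_bounded_hermite_deriv, OF _ _ \<open>r > 0\<close> \<open>b > 0\<close> \<open>r > 0\<close> \<open>b > 0\<close>]
  have \<sigma>: "1 \<le> \<sigma>" "1 / b \<le> 2 * \<sigma>"
    using assms(2) by (auto simp: assms(3) max_def field_simps)
  have gevrey: "f \<in> gevrey \<sigma>" if f: "f \<in> H" for f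
  proof (rule gevreyI_square_bound[OF higher(2)[OF f f] _ \<sigma>])
    fix R :: real
    have "((deriv ^^ l) f x)\<^sup>2 \<le> (ip f f * (exp (R\<^sup>2) * ?A)) * ?q ^ l * fact l powr (1 / b)"
      if x: "\<bar>x\<bar> \<le> R" for l x
    proof -
      have A: "0 \<le> ?A"
        by (intro suminf_nonneg summable_exp_minus_powr[OF assms(2) rate_pos[OF assms(1,2)]]) simp
      have "x\<^sup>2 \<le> R\<^sup>2" using x power_mono[of "\<bar>x\<bar>" R 2] by simp
      then have "exp (x\<^sup>2) * ?A * ?q ^ l * fact l powr (1 / b) \<le> exp (R\<^sup>2) * ?A * ?q ^ l * fact l powr (1 / b)"
        using A by (intro mult_right_mono) auto
      with suminf_hermite_deriv_le[OF assms(1,2), of l x]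
      have "ip f f * (\<Sum>n. ?w n * (hermite_deriv l n x)\<^sup>2)
          \<le> ip f f * (exp (R\<^sup>2) * ?A * ?q ^ l * fact l powr (1 / b))"
        by (intro mult_left_mono ip_nonneg f) linarith
      with dominated_pointwise[OF higher(1)[OF f f], of l x] show ?thesis
        by (simp only: mult.assoc)
    qed
    then show "\<exists>M q. \<forall>l x. \<bar>x\<bar> \<le> R \<longrightarrow> ((deriv ^^ l) f x)\<^sup>2 \<le> M * q ^ l * fact l powr (1 / b)"
      by blast
  qed
  moreover have "real_analytic f" if f: "f \<in> H" and b: "b \<ge> 1 / 2" for f
  proof (rule real_analytic_if_deriv_bound[OF higher(2)[OF f f]])
    have "\<sigma> = 1" using b by (simp add: assms(3) max_def field_simps)
    then have gev: "\<forall>R>0. \<exists>c>0. \<forall>l. \<forall>x\<in>{- R..R}.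
        \<bar>(deriv ^^ l) f x\<bar> \<le> (c ^ (l + 1) * fact l) powr 1"
      using gevrey[OF f] unfolding gevrey_def by blast
    fix R :: real
    assume "0 < R"
    with gev obtain c where "c > 0" "\<forall>l. \<forall>x\<in>{- R..R}.
        \<bar>(deriv ^^ l) f x\<bar> \<le> (c ^ (l + 1) * fact l) powr 1" by blast
    then show "\<exists>c>0. \<forall>l. \<forall>x\<in>{- R..R}. \<bar>(deriv ^^ l) f x\<bar> \<le> c ^ (l + 1) * fact l"
      by (intro exI[of _ c]) simp
  qed
  ultimately show ?thesis by blast
qed

end
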